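(* Let $k$ be a positive integer, let $\sigma \geq 1$ be a real number with $\sigma k \in \mathbb{N}$, and let $\delta=2+\sigma + \frac{1}{3\sigma}$. Then there exist finite graphs with arbitrarily many vertices whose average degree $\frac{2|E(G)|}{|V(G)|}$ is greater than $\delta k -2$ and which have no $(k+1)$-connected subgraph on more than $(1+\sigma)k$ vertices.
   Context: Graphs are finite and simple. A graph is $(k+1)$-connected if it has more than $k+1$ vertices and remains connected after deleting any set of at most $k$ vertices. *)

theory Defs
  imports Complex_Main "Graph_Theory.Digraph_Component"
begin

text \<open>
  A finite simple graph is a \<^locale>\<open>pair_graph\<close>: a finite, loop-free, symmetric set of ordered pairs
  on a finite vertex set.  Every undirected edge thus gives two arcs, so edges are counted as
  two-element sets of vertices.
\<close>

definition uedges :: "'a pair_pre_digraph \<Rightarrow> 'a set set" where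
  "uedges G = {{u, v} | u v. (u, v) \<in> parcs G}"

definition average_degree :: "'a pair_pre_digraph \<Rightarrow> real" where
  "average_degree G = 2 * real (card (uedges G)) / real (card (pverts G))"

text \<open>
  Intended for finite graphs (the cardinality of an infinite set is 0).  The name of
  \<^const>\<open>Digraph_Component.connected\<close> is qualified since \<^theory>\<open>Complex_Main\<close> has a topological
  constant of the same base name.
\<close>

definition vertex_connected :: "nat \<Rightarrow> 'a pair_pre_digraph \<Rightarrow> bool" where
  "vertex_connected m G \<longleftrightarrow>
     card (pverts G) > m \<and>
     (\<forall>S \<subseteq> pverts G. card S < m \<longrightarrow>
        Digraph_Component.connected (with_proj G \<restriction> (pverts G - S)))"

end

theory Submission
  imports Defs
begin

text \<open>
  Write \<open>n = (1 + \<sigma>) k\<close>.  Start with the clique on \<open>n\<close> vertices and two disjoint \<open>k\<close>-sets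
  \<open>S\<close>, \<open>T\<close> in it.  Repeatedly take two copies of the current graph and identify them along \<open>T\<close>.
  Splitting \<open>S = A \<union> B\<close> along a large cut, the new sets are \<open>S' = A\<^sub>1 \<union> B\<^sub>2\<close> and
  \<open>T' = B\<^sub>1 \<union> A\<^sub>2\<close> (indices denote the copy); since there are no edges between the two copies of
  \<open>S\<close>, the number of edges inside \<open>S\<close> and inside \<open>T\<close> is at least halved in every step.  So the edges
  lost by the identifications form a geometric series: at most \<open>k (k - 1) / 3\<close> per clique, whereas
  each clique contributes \<open>\<sigma> k\<close> new vertices.  A highly connected subgraph cannot be
  spread over both sides of an identification, so it lies within a single clique.
\<close>

section \<open>Graphs glued together along few vertices\<close>

text \<open>The graph meant is always the one that the fixed relation \<open>E\<close> induces on
  the set, so both sides of \<open>glue\<close> are judged against the same arcs. Crossing arcs are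
  excluded in one direction only; symmetry of \<open>E\<close> is brought in later for the
  other.\<close>

inductive decomposable :: "nat \<Rightarrow> nat \<Rightarrow> 'a rel \<Rightarrow> 'a set \<Rightarrow> bool" for k n E where
  small: "finite V \<Longrightarrow> card V \<le> n \<Longrightarrow> decomposable k n E V"
| glue: "decomposable k n E U \<Longrightarrow> decomposable k n E V \<Longrightarrow> card (U \<inter> V) \<le> k \<Longrightarrow>
    E \<inter> (U - V) \<times> (V - U) = {} \<Longrightarrow> decomposable k n E (U \<union> V)"

lemma decomposable_finite: "decomposable k n E V \<Longrightarrow> finite V"
  by (induction rule: decomposable.induct) auto

text \<open>Arcs with an end outside \<open>V\<close> are irrelevant, and removing arcs inside
  \<open>V\<close> creates no crossing arc. Hence one copy keeps its decomposition when the arcs of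
  the other copy are added.\<close>

lemma decomposable_mono:
  assumes "decomposable k n E V" "F \<inter> V \<times> V \<subseteq> E"
  shows "decomposable k n F V"
  using assms
proof (induction rule: decomposable.induct)
  case (glue U V)
  have "decomposable k n F U" "decomposable k n F V"
    using glue.prems by (auto intro: glue.IH)
  then show ?case
    using glue.hyps glue.prems by (intro decomposable.glue) blast+
qed (auto intro: decomposable.small)

lemma decomposable_image:
  assumes "decomposable k n E V" "inj f"
  shows "decomposable k n (map_prod f f ` E) (f ` V)"
  using assms(1)
proof (induction rule: decomposable.induct)
  case (small V)
  then show ?case
    using card_image_le[of V f] by (intro decomposable.small) auto
next
  case (glue U V)
  have "card (f ` U \<inter> f ` V) \<le> k"
    using glue.hyps(3) assms(2) by (metis card_image image_Int inj_on_subset subset_UNIV)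
  moreover have "map_prod f f ` E \<inter> (f ` U - f ` V) \<times> (f ` V - f ` U) = {}"
    using glue.hyps(4) assms(2) by (auto simp: inj_def)
  ultimately show ?case
    unfolding image_Un using glue.IH by (intro decomposable.glue)
qed

section \<open>Highly connected subgraphs stay within one piece\<close>

text \<open>If no arc crossed, everything reachable from a point of \<open>X\<close> would stay in
  \<open>X\<close>. Reachability is taken in the symmetric closure, so the crossing arc may have
  either orientation.\<close>

lemma connected_no_cut:
  assumes "Digraph_Component.connected G" "verts G = X \<union> Y" "X \<inter> Y = {}" "X \<noteq> {}" "Y \<noteq> {}"
  obtains e where "e \<in> arcs G" "tail G e \<in> X \<and> head G e \<in> Y \<or> tail G e \<in> Y \<and> head G e \<in> X"
proof -
  obtain x y where xy: "x \<in> X" "y \<in> Y" using assms by blast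
  have "(x, y) \<in> rtrancl_on (verts G) (parcs (mk_symmetric G))"
    using assms(1,2) xy
    by (auto simp: Digraph_Component.connected_def strongly_connected_def reachable_def)
  moreover have "v \<in> X" if "(x, v) \<in> rtrancl_on (verts G) (parcs (mk_symmetric G))"
    and "\<And>e. e \<in> arcs G \<Longrightarrow> \<not> (tail G e \<in> X \<and> head G e \<in> Y \<or> tail G e \<in> Y \<and> head G e \<in> X)" for v
    using that(1)
  proof (induction rule: rtrancl_on_induct)
    case base
    then show ?case using xy by simp
  next
    case (step u v)
    then show ?case using that(2) assms(2) by (auto simp: parcs_mk_symmetric)
  qed
  ultimately show thesis using that xy assms(3) by blast
qed

lemma decomposable_no_large_vertex_connected:
  assumes "decomposable k n E V" "sym E" "pverts H \<subseteq> V" "parcs H \<subseteq> E"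
    and "vertex_connected (k + 1) H"
  shows "card (pverts H) \<le> n"
  using assms(1,3)
proof (induction rule: decomposable.induct)
  case (small V)
  then show ?case using card_mono le_trans by blast
next
  case (glue U V)
  show ?case
  proof (cases "pverts H \<subseteq> U \<or> pverts H \<subseteq> V")
    case True
    then show ?thesis using glue.IH by blast
  next
    case False
    \<comment> \<open>The separator: \<open>H\<close> must survive the deletion of these at most
      \<open>k\<close> vertices, yet what is left meets both sides of the gluing.\<close>
    define S where "S = pverts H \<inter> (U \<inter> V)"
    have "finite (U \<inter> V)" using glue.hyps(1) decomposable_finite by blast
    then have "card S \<le> card (U \<inter> V)" by (intro card_mono) (auto simp: S_def)
    then have "card S < k + 1" using glue.hyps(3) by simp
    then have "Digraph_Component.connected (with_proj H \<restriction> (pverts H - S))"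
      using assms(5) by (auto simp: vertex_connected_def S_def)
    moreover have "pverts H - S = (pverts H \<inter> (U - V)) \<union> (pverts H \<inter> (V - U))"
      using glue.prems by (auto simp: S_def)
    ultimately obtain e where "e \<in> parcs H"
      "fst e \<in> U - V \<and> snd e \<in> V - U \<or> fst e \<in> V - U \<and> snd e \<in> U - V"
      using False glue.prems
      by (elim connected_no_cut[where X = "pverts H \<inter> (U - V)" and Y = "pverts H \<inter> (V - U)"]) auto
    then have "E \<inter> (U - V) \<times> (V - U) \<noteq> {}"
      using assms(2,4) by (cases e) (auto dest: symD)
    then show ?thesis using glue.hyps(4) by contradiction
  qed
qed

section \<open>Large cuts\<close>

text \<open>Greedy cut: vertices are added one at a time, each to the side to which it has fewer
  arcs, so at least half of the new arcs cross. Irreflexivity ensures that every new arc joins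
  \<open>x\<close> to an older vertex.\<close>

lemma bipartition_halving_arcs:
  assumes "finite S" "irrefl E"
  shows "\<exists>A\<subseteq>S. 2 * (card (E \<inter> A \<times> A) + card (E \<inter> (S - A) \<times> (S - A))) \<le> card (E \<inter> S \<times> S)"
  using assms(1)
proof (induction rule: finite_induct)
  case empty
  then show ?case by simp
next
  case (insert x S)
  then obtain A where A: "A \<subseteq> S"
    "2 * (card (E \<inter> A \<times> A) + card (E \<inter> (S - A) \<times> (S - A))) \<le> card (E \<inter> S \<times> S)"
    by blast
  define N where "N B = E \<inter> ({x} \<times> B \<union> B \<times> {x})" for B
  have card_insert: "card (E \<inter> insert x B \<times> insert x B) = card (E \<inter> B \<times> B) + card (N B)"
    if "B \<subseteq> S" for B
  proof -
    have "E \<inter> insert x B \<times> insert x B = (E \<inter> B \<times> B) \<union> N B"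
      using assms(2) by (auto simp: N_def irrefl_def)
    moreover have "finite B" using that insert.hyps(1) finite_subset by blast
    moreover have "(E \<inter> B \<times> B) \<inter> N B = {}" using that insert.hyps(2) by (auto simp: N_def)
    ultimately show ?thesis by (simp add: card_Un_disjoint N_def)
  qed
  have "finite A" using A insert.hyps(1) finite_subset by blast
  have "N S = N A \<union> N (S - A)" using A by (auto simp: N_def)
  moreover have "N A \<inter> N (S - A) = {}"
    using A insert.hyps(2) by (auto simp: N_def)
  ultimately have sum: "card (N S) = card (N A) + card (N (S - A))"
    using \<open>finite A\<close> insert.hyps(1) by (simp add: card_Un_disjoint N_def)
  show ?case
  proof (cases "card (N A) \<le> card (N (S - A))")
    case True
    have "insert x S - insert x A = S - A" using insert.hyps(2) by auto
    then show ?thesis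
      using A True sum card_insert[of S] card_insert[of A] by (intro exI[of _ "insert x A"]) auto
  next
    case False
    have "insert x S - A = insert x (S - A)" using insert.hyps(2) A by auto
    then show ?thesis
      using A False sum card_insert[of S] card_insert[of "S - A"] by (intro exI[of _ A]) auto
  qed
qed

section \<open>The doubling step\<close>

text \<open>Shifting by a bound \<open>M\<close> of \<open>V\<close> moves every vertex outside
  \<open>T\<close> off \<open>V\<close>. The second copy thus again consists of natural numbers, and
  the step can be iterated within one type.\<close>

lemma doubling_map:
  fixes V :: "nat set"
  assumes "finite V" "T \<subseteq> V"
  obtains f where "inj f" "V \<inter> f ` V = T" "\<And>t. t \<in> T \<Longrightarrow> f t = t"
proof -
  obtain M where M: "\<And>v. v \<in> V \<Longrightarrow> v < M"
    using assms(1) by (auto simp: finite_nat_set_iff_bounded)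
  define f where "f v = (if v \<in> T then v else v + M)" for v
  have less: "t < u + M" if "t \<in> T" for t u
    using M[of t] assms(2) that by auto
  have "inj f"
  proof (rule injI)
    fix u v assume "f u = f v"
    then show "u = v" using less[of u v] less[of v u] by (auto simp: f_def split: if_splits)
  qed
  moreover have "f v \<in> V \<longleftrightarrow> v \<in> T" for v
    using M[of "v + M"] assms(2) by (auto simp: f_def)
  then have "V \<inter> f ` V = T"
    using assms(2) by (force simp: f_def)
  ultimately show thesis
    using that by (simp add: f_def)
qed

text \<open>Only the arcs inside \<open>T\<close> are shared by the copies, whence the equation for
  \<open>card E'\<close>. The new \<open>S'\<close> and \<open>T'\<close> use the same bipartition
  of \<open>S\<close> with the copies swapped, so both bounds refer to \<open>S\<close>
  alone.\<close>

lemma doubling_step: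
  fixes V :: "nat set"
  assumes fin: "finite V" and E: "E \<subseteq> V \<times> V" "sym E" "irrefl E"
    and ST: "S \<subseteq> V" "T \<subseteq> V" "S \<inter> T = {}" "card S = k" "card T = k"
    and dec: "decomposable k n E V"
  obtains V' :: "nat set" and E' S' T' where
    "finite V'" "E' \<subseteq> V' \<times> V'" "sym E'" "irrefl E'"
    "S' \<subseteq> V'" "T' \<subseteq> V'" "S' \<inter> T' = {}" "card S' = k" "card T' = k" "decomposable k n E' V'"
    "card V' + k = 2 * card V" "card E' + card (E \<inter> T \<times> T) = 2 * card E"
    "2 * card (E' \<inter> S' \<times> S') \<le> card (E \<inter> S \<times> S)"
    "2 * card (E' \<inter> T' \<times> T') \<le> card (E \<inter> S \<times> S)"
proof -
  obtain f where f: "inj f" "V \<inter> f ` V = T" "\<And>t. t \<in> T \<Longrightarrow> f t = t"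
    using doubling_map[OF fin ST(2)] by blast
  have finE: "finite E" using E(1) fin finite_subset by blast
  have finS: "finite S" using ST(1) fin finite_subset by blast
  have f_eq: "f u = f v \<longleftrightarrow> u = v" for u v using f(1) by (auto simp: inj_def)
  \<comment> \<open>If \<open>f v\<close> lies in \<open>V\<close>, it lies in \<open>T\<close> and
    is fixed by \<open>f\<close>, so \<open>f v = v\<close> by injectivity.\<close>
  have f_in: "f v \<in> V \<longleftrightarrow> v \<in> T" if "v \<in> V" for v
    using that f ST(2) f_eq by (metis IntI image_eqI subsetD)
  obtain A where A: "A \<subseteq> S"
    "2 * (card (E \<inter> A \<times> A) + card (E \<inter> (S - A) \<times> (S - A))) \<le> card (E \<inter> S \<times> S)"
    using bipartition_halving_arcs[OF finS E(3)] by blast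
  define F where "F = map_prod f f ` E"
  define V' where "V' = V \<union> f ` V"
  define E' where "E' = E \<union> F"
  have injF: "inj (map_prod f f)" using f(1) by (simp add: prod.inj_map)
  have F_sub: "F \<subseteq> f ` V \<times> f ` V" using E(1) by (auto simp: F_def)
  have F_in: "(f u, f v) \<in> F \<longleftrightarrow> (u, v) \<in> E" for u v
    using inj_image_mem_iff[OF injF, of "(u, v)" E] by (simp add: F_def)
  have F_T: "(u, v) \<in> F \<longleftrightarrow> (u, v) \<in> E" if "u \<in> T" "v \<in> T" for u v
    using F_in[of u v] f(3) that by simp
  have "E \<inter> F = E \<inter> T \<times> T"
    using F_T F_sub E(1) f(2) by blast
  moreover have "card F = card E"
    unfolding F_def using injF by (simp add: card_image inj_on_subset)
  moreover have "finite F" using finE by (simp add: F_def)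
  ultimately have cardE: "card E' + card (E \<inter> T \<times> T) = 2 * card E"
    using card_Un_Int[OF finE, of F] by (simp add: E'_def)
  have "card (f ` V) = card V" using f(1) by (simp add: card_image inj_on_subset)
  then have cardV: "card V' + k = 2 * card V"
    using card_Un_Int[OF fin, of "f ` V"] fin f(2) ST(5) by (simp add: V'_def)
  have "sym F" using E(2) by (auto simp: F_def sym_def)
  then have "sym E'" using E(2) by (auto simp: E'_def sym_def)
  have "irrefl E'" using E(3) by (auto simp: E'_def F_def irrefl_def f_eq)
  have "decomposable k n E' V'" unfolding V'_def
  proof (rule decomposable.glue)
    \<comment> \<open>An arc of \<open>F\<close> with both ends in \<open>V\<close> has both ends in
      \<open>T\<close>, where the two copies agree; hence \<open>E'\<close> adds nothing inside
      \<open>V\<close>.\<close>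
    show "decomposable k n E' V"
      using dec by (rule decomposable_mono) (use F_sub F_T f(2) in \<open>auto simp: E'_def\<close>)
    have "E' \<inter> f ` V \<times> f ` V \<subseteq> F"
      using E(1) F_T f(2) by (auto simp: E'_def)
    then show "decomposable k n E' (f ` V)"
      using decomposable_image[OF dec f(1)] decomposable_mono F_def by blast
    show "card (V \<inter> f ` V) \<le> k" using f(2) ST(5) by simp
    show "E' \<inter> (V - f ` V) \<times> (f ` V - V) = {}" using E(1) F_sub by (auto simp: E'_def)
  qed
  \<comment> \<open>Stated for any ordered bipartition, since it is applied to \<open>A\<close>,
    \<open>S - A\<close> and to the swapped pair.\<close>
  have copy: "A' \<union> f ` B' \<subseteq> V'" "card (A' \<union> f ` B') = k"
    "2 * card (E' \<inter> (A' \<union> f ` B') \<times> (A' \<union> f ` B')) \<le> card (E \<inter> S \<times> S)"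
    if AB: "A' \<union> B' = S" "A' \<inter> B' = {}"
      "2 * (card (E \<inter> A' \<times> A') + card (E \<inter> B' \<times> B')) \<le> card (E \<inter> S \<times> S)" for A' B'
  proof -
    have fin': "finite A'" "finite B'" using AB finS by auto
    have sub: "A' \<subseteq> V" "B' \<subseteq> V" "A' \<inter> T = {}" "B' \<inter> T = {}" using AB ST by auto
    show "A' \<union> f ` B' \<subseteq> V'" using sub by (auto simp: V'_def)
    have "A' \<inter> f ` B' = {}" using sub f_in by blast
    then have "card (A' \<union> f ` B') = card A' + card B'"
      using fin' f(1) by (simp add: card_Un_disjoint card_image inj_on_subset)
    then show "card (A' \<union> f ` B') = k"
      using AB fin' ST(4) by (metis card_Un_disjoint)
    have "E' \<inter> (A' \<union> f ` B') \<times> (A' \<union> f ` B')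
        \<subseteq> (E \<inter> A' \<times> A') \<union> map_prod f f ` (E \<inter> B' \<times> B')" (is "?L \<subseteq> ?R")
    proof (rule subrelI)
      fix x y assume xy: "(x, y) \<in> ?L"
      show "(x, y) \<in> ?R"
      proof (cases "(x, y) \<in> E")
        case True
        then have "x \<in> V" "y \<in> V" using E(1) by auto
        then have "x \<notin> f ` B'" "y \<notin> f ` B'" using sub f_in by blast+
        then show ?thesis using xy True by auto
      next
        case False
        then obtain u v where uv: "x = f u" "y = f v" "(u, v) \<in> E"
          using xy by (auto simp: E'_def F_def)
        then have "x \<notin> A'" "y \<notin> A'" using E(1) sub f(2) by blast+
        then have "u \<in> B'" "v \<in> B'" using xy uv by (auto simp: f_eq)
        then show ?thesis using uv by auto
      qed
    qed
    then have "card ?L \<le> card ?R"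
      using fin' by (intro card_mono) auto
    also have "\<dots> \<le> card (E \<inter> A' \<times> A') + card (map_prod f f ` (E \<inter> B' \<times> B'))"
      by (rule card_Un_le)
    also have "\<dots> \<le> card (E \<inter> A' \<times> A') + card (E \<inter> B' \<times> B')"
      using fin' by (intro add_left_mono card_image_le) auto
    finally show "2 * card ?L \<le> card (E \<inter> S \<times> S)" using AB(3) by (meson le_trans mult_le_mono2)
  qed
  have V'_fin: "finite V'" using fin by (simp add: V'_def)
  have E'_sub: "E' \<subseteq> V' \<times> V'" using E(1) F_sub by (auto simp: E'_def V'_def)
  have "f s \<notin> S" if "s \<in> S" for s using that f_in ST by blast
  then have "(A \<union> f ` (S - A)) \<inter> ((S - A) \<union> f ` A) = {}"
    using A(1) by (auto simp: f_eq)
  moreover have "A \<union> (S - A) = S" "A \<inter> (S - A) = {}" "(S - A) \<union> A = S" "(S - A) \<inter> A = {}"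
    using A(1) by auto
  ultimately show thesis
    using that[of V' E' "A \<union> f ` (S - A)" "(S - A) \<union> f ` A"] copy[of A "S - A"] copy[of "S - A" A]
      A(2) fin V'_fin E'_sub cardE cardV \<open>sym E'\<close> \<open>irrefl E'\<close> \<open>decomposable k n E' V'\<close>
    by (simp add: add.commute)
qed

section \<open>Iteration and counting\<close>

lemma card_arcs_complete:
  assumes "finite V"
  shows "card (V \<times> V - Id_on V) = card V * (card V - 1)"
proof -
  have "Id_on V = (\<lambda>v. (v, v)) ` V" by (auto simp: Id_on_def)
  then have "card (Id_on V) = card V" by (simp add: card_image inj_on_def)
  moreover have "Id_on V \<subseteq> V \<times> V" by auto
  ultimately show ?thesis
    using assms by (simp add: card_Diff_subset finite_subset card_cartesian_product diff_mult_distrib2)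
qed

text \<open>With \<open>m = k * (k - 1)\<close>, the arc count at least doubles minus
  \<open>m / 2 ^ i\<close>. Since \<open>2 * (2 / 3) - 1\<close> is half of \<open>2 / 3\<close>,
  the term \<open>2 / 3 * m / 2 ^ i\<close> absorbs this loss exactly; the coefficient of
  \<open>2 ^ i\<close> is then fixed by the clique at \<open>i = 0\<close>. The vertex count follows
  v \<mapsto> 2v - k, whose fixed point is k.\<close>

lemma iterated_doubling:
  assumes "2 * k \<le> n"
  shows "\<exists>(V :: nat set) E S T. finite V \<and> E \<subseteq> V \<times> V \<and> sym E \<and> irrefl E \<and>
    S \<subseteq> V \<and> T \<subseteq> V \<and> S \<inter> T = {} \<and> card S = k \<and> card T = k \<and> decomposable k n E V \<and>
    card V = (n - k) * 2 ^ i + k \<and>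
    2 ^ i * card (E \<inter> S \<times> S) \<le> k * (k - 1) \<and> 2 ^ i * card (E \<inter> T \<times> T) \<le> k * (k - 1) \<and>
    2 ^ i * (real (n * (n - 1)) - 2 / 3 * real (k * (k - 1))) + 2 / 3 * real (k * (k - 1)) / 2 ^ i
      \<le> real (card E)"
proof (induction i)
  case 0
  define V where "V = {..<n}"
  define E where "E = V \<times> V - Id_on V"
  have restrict: "E \<inter> S \<times> S = S \<times> S - Id_on S" if "S \<subseteq> V" for S
    using that by (auto simp: E_def)
  have sub: "{..<k} \<subseteq> V" "{k..<2 * k} \<subseteq> V" using assms by (auto simp: V_def)
  show ?case
  proof (intro exI conjI)
    show "decomposable k n E V" by (rule decomposable.small) (auto simp: V_def)
    show "{..<k} \<inter> {k..<2 * k} = {}" by auto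
    show "2 ^ 0 * card (E \<inter> {..<k} \<times> {..<k}) \<le> k * (k - 1)"
      "2 ^ 0 * card (E \<inter> {k..<2 * k} \<times> {k..<2 * k}) \<le> k * (k - 1)"
      using restrict sub by (simp_all add: card_arcs_complete)
    show "2 ^ 0 * (real (n * (n - 1)) - 2 / 3 * real (k * (k - 1)))
        + 2 / 3 * real (k * (k - 1)) / 2 ^ 0 \<le> real (card E)"
      using card_arcs_complete[of V] by (simp add: E_def V_def)
  qed (use sub assms in \<open>auto simp: V_def E_def sym_def irrefl_def\<close>)
next
  case (Suc i)
  then obtain V :: "nat set" and E S T where IH: "finite V" "E \<subseteq> V \<times> V" "sym E" "irrefl E"
    "S \<subseteq> V" "T \<subseteq> V" "S \<inter> T = {}" "card S = k" "card T = k" "decomposable k n E V"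
    and cardV: "card V = (n - k) * 2 ^ i + k"
    and S: "2 ^ i * card (E \<inter> S \<times> S) \<le> k * (k - 1)"
    and T: "2 ^ i * card (E \<inter> T \<times> T) \<le> k * (k - 1)"
    and cardE: "2 ^ i * (real (n * (n - 1)) - 2 / 3 * real (k * (k - 1)))
      + 2 / 3 * real (k * (k - 1)) / 2 ^ i \<le> real (card E)"
    by blast
  obtain V' :: "nat set" and E' S' T' where new:
    "finite V'" "E' \<subseteq> V' \<times> V'" "sym E'" "irrefl E'"
    "S' \<subseteq> V'" "T' \<subseteq> V'" "S' \<inter> T' = {}" "card S' = k" "card T' = k" "decomposable k n E' V'"
    and cardV': "card V' + k = 2 * card V"
    and cardE': "card E' + card (E \<inter> T \<times> T) = 2 * card E"
    and S': "2 * card (E' \<inter> S' \<times> S') \<le> card (E \<inter> S \<times> S)"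
    and T': "2 * card (E' \<inter> T' \<times> T') \<le> card (E \<inter> S \<times> S)"
    using doubling_step[OF IH] by blast
  have ST': "2 ^ Suc i * x \<le> k * (k - 1)" if "2 * x \<le> card (E \<inter> S \<times> S)" for x
  proof -
    have "2 ^ Suc i * x = 2 ^ i * (2 * x)" by simp
    also have "\<dots> \<le> 2 ^ i * card (E \<inter> S \<times> S)" using that by (rule mult_le_mono2)
    finally show ?thesis using S by (rule le_trans)
  qed
  define m where "m = real (k * (k - 1))"
  define c where "c = real (n * (n - 1)) - 2 / 3 * m"
  have "2 ^ i * real (card (E \<inter> T \<times> T)) \<le> m"
    using of_nat_mono[OF T, where 'a = real] by (simp add: m_def)
  then have t: "real (card (E \<inter> T \<times> T)) \<le> m / 2 ^ i"
    by (simp add: pos_le_divide_eq mult.commute)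
  have e: "2 ^ i * c + 2 / 3 * m / 2 ^ i \<le> real (card E)"
    using cardE by (simp only: c_def m_def)
  have "2 ^ Suc i * c + 2 / 3 * m / 2 ^ Suc i = 2 * (2 ^ i * c + 2 / 3 * m / 2 ^ i) - m / 2 ^ i"
    by (simp add: field_simps)
  also have "\<dots> \<le> 2 * real (card E) - real (card (E \<inter> T \<times> T))"
    using e t by (intro diff_mono mult_left_mono) auto
  also have "\<dots> = real (card E')"
    using arg_cong[OF cardE', of real] by simp
  finally have "2 ^ Suc i * c + 2 / 3 * m / 2 ^ Suc i \<le> real (card E')" .
  moreover have "card V' = (n - k) * 2 ^ Suc i + k"
    using cardV cardV' by simp
  ultimately show ?case
    using new ST'[OF S'] ST'[OF T'] unfolding c_def m_def by blast
qed

section \<open>From arcs to edges, and the average degree\<close>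

text \<open>An arc is determined by its underlying set together with the truth value of
  \<open>u < v\<close>.\<close>

lemma card_parcs_le_uedges:
  fixes G :: "'a::linorder pair_pre_digraph"
  assumes "finite (parcs G)"
  shows "card (parcs G) \<le> 2 * card (uedges G)"
proof -
  let ?h = "\<lambda>(u, v). ({u, v}, u < v)"
  have "uedges G = (\<lambda>(u, v). {u, v}) ` parcs G" by (auto simp: uedges_def)
  then have fin: "finite (uedges G)" using assms by simp
  have "inj_on ?h (parcs G)" by (auto simp: inj_on_def doubleton_eq_iff)
  moreover have "?h ` parcs G \<subseteq> uedges G \<times> (UNIV :: bool set)" by (auto simp: uedges_def)
  ultimately have "card (parcs G) \<le> card (uedges G \<times> (UNIV :: bool set))"
    using fin by (intro card_inj_on_le) auto
  then show ?thesis by (simp add: card_cartesian_product)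
qed

theorem theorem2:
  fixes k :: nat and \<sigma> \<delta> :: real
  assumes "k \<ge> 1"
    and "\<sigma> \<ge> 1"
    and "\<sigma> * real k \<in> \<nat>"
    and "\<delta> = 2 + \<sigma> + 1 / (3 * \<sigma>)"
  shows "\<forall>N. \<exists>G :: nat pair_pre_digraph.
           pair_graph G \<and> card (pverts G) \<ge> N \<and>
           average_degree G > \<delta> * real k - 2 \<and>
           \<not> (\<exists>H :: nat pair_pre_digraph.
                 pair_graph H \<and> subgraph (with_proj H) (with_proj G) \<and>
                 vertex_connected (k + 1) H \<and>
                 real (card (pverts H)) > (1 + \<sigma>) * real k)"
proof
  fix N
  obtain l where l: "\<sigma> * real k = real l" using assms(3) by (auto elim: Nats_cases)
  define n where "n = k + l"
  have n: "real n = (1 + \<sigma>) * real k" using l by (simp add: n_def algebra_simps)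
  have "real k \<le> real l" using l assms(2) by (metis mult_right_mono mult_1 of_nat_0_le_iff)
  then have kl: "k \<le> l" by simp
  \<comment> \<open>One exponent for two purposes: \<open>2 ^ i\<close> exceeds \<open>N\<close>,
    and it outweighs the constant number of vertices in \<open>V\<close> beyond the \<open>l\<close>
    per clique.\<close>
  obtain i where i: "real N + 2 * (\<delta> * real k) < 2 ^ i"
    using real_arch_pow[of 2 "real N + 2 * (\<delta> * real k)"] by auto
  have "2 * k \<le> n" using kl by (simp add: n_def)
  from iterated_doubling[OF this, of i]
  obtain V :: "nat set" and E where V: "finite V" "E \<subseteq> V \<times> V" "sym E" "irrefl E"
    "decomposable k n E V"
    and cardV: "card V = (n - k) * 2 ^ i + k"
    and cardE: "2 ^ i * (real (n * (n - 1)) - 2 / 3 * real (k * (k - 1)))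
      + 2 / 3 * real (k * (k - 1)) / 2 ^ i \<le> real (card E)"
    by blast
  define G where "G = \<lparr>pverts = V, parcs = E\<rparr>"
  have finE: "finite E" using V finite_subset by blast
  have "pair_graph G"
    by unfold_locales
      (use V finE in \<open>auto simp: G_def irrefl_def Digraph.symmetric_def subset_iff\<close>)
  moreover have "N \<le> card (pverts G)"
  proof -
    have "0 \<le> \<delta> * real k" using assms by simp
    then have "real N < 2 ^ i" using i by linarith
    then have "N \<le> 1 * 2 ^ i" by simp
    also have "\<dots> \<le> (n - k) * 2 ^ i" using kl assms(1) by (intro mult_le_mono1) (simp add: n_def)
    finally show ?thesis by (simp add: G_def cardV)
  qed
  moreover have "\<delta> * real k - 2 < average_degree G"
  proof -
    define K where "K = real k"
    have K: "K \<ge> 1" using assms(1) by (simp add: K_def)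
    have v: "real (card V) = \<sigma> * K * 2 ^ i + K" using l by (simp add: cardV n_def K_def)
    \<comment> \<open>The right-hand side is \<open>(1 + \<sigma>)\<^sup>2 - 2 / 3\<close>, the
      coefficient of \<open>K\<^sup>2\<close> in the arcs gained per clique; this is where the value
      of \<delta> comes from.\<close>
    have "\<delta> * \<sigma> = 2 * \<sigma> + \<sigma>\<^sup>2 + 1 / 3"
      using assms(2,4) by (simp add: field_simps power2_eq_square)
    then have dsK: "(\<delta> * K - 2) * (\<sigma> * K) = (2 * \<sigma> + \<sigma>\<^sup>2 + 1 / 3) * K\<^sup>2 - 2 * \<sigma> * K"
      by (simp add: algebra_simps power2_eq_square)
    have nn: "real (n * (n - 1)) = ((1 + \<sigma>) * K)\<^sup>2 - (1 + \<sigma>) * K"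
    proof -
      have "real (n * (n - 1)) = real n * (real n - 1)"
        by (cases n) (auto simp: algebra_simps)
      then show ?thesis by (simp add: n K_def power2_eq_square algebra_simps)
    qed
    have kk: "real (k * (k - 1)) = K\<^sup>2 - K"
      using assms(1) by (simp add: K_def power2_eq_square algebra_simps of_nat_diff)
    have "(\<delta> * K - 2) * real (card V)
        = 2 ^ i * ((\<delta> * K - 2) * (\<sigma> * K)) + (\<delta> * K - 2) * K"
      by (simp add: v algebra_simps)
    \<comment> \<open>The quadratic terms cancel. Comparing the linear ones leaves a surplus of
      \<open>(\<sigma> - 1 / 3) * K\<close> arcs per clique, to be set against the fixed cost
      \<open>(\<delta> * K - 2) * K\<close> of the \<open>K\<close> extra vertices.\<close>
    also have "\<dots> = 2 ^ i * (((1 + \<sigma>) * K)\<^sup>2 - (1 + \<sigma>) * K - 2 / 3 * (K\<^sup>2 - K))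
        - (2 ^ i * (\<sigma> - 1 / 3) - (\<delta> * K - 2)) * K"
      unfolding dsK by (simp add: field_simps power2_eq_square)
    also have "\<dots> < real (card E)"
    proof -
      have "2 ^ i * (2 / 3) \<le> 2 ^ i * (\<sigma> - 1 / 3)"
        using assms(2) by (intro mult_left_mono) auto
      moreover have "2 * (\<delta> * K) < 2 ^ i" using i by (simp add: K_def)
      moreover have "0 \<le> \<delta> * K" using assms K by simp
      ultimately have "0 < 2 ^ i * (\<sigma> - 1 / 3) - (\<delta> * K - 2)" by linarith
      then have "0 < (2 ^ i * (\<sigma> - 1 / 3) - (\<delta> * K - 2)) * K" using K by simp
      moreover have "0 \<le> 2 / 3 * real (k * (k - 1)) / 2 ^ i" by simp
      ultimately show ?thesis using cardE unfolding nn kk by linarith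
    qed
    also have "\<dots> \<le> 2 * real (card (uedges G))"
      using card_parcs_le_uedges[of G] finE by (simp add: G_def)
    finally have "(\<delta> * K - 2) * real (card V) < 2 * real (card (uedges G))" .
    moreover have "0 < real (card V)" using v K assms(2) by (simp add: add_nonneg_pos)
    ultimately show ?thesis
      by (simp add: average_degree_def G_def K_def pos_less_divide_eq)
  qed
  moreover have "\<not> (\<exists>H :: nat pair_pre_digraph.
      pair_graph H \<and> subgraph (with_proj H) (with_proj G) \<and>
      vertex_connected (k + 1) H \<and> real (card (pverts H)) > (1 + \<sigma>) * real k)"
  proof clarify
    fix H :: "nat pair_pre_digraph"
    assume H: "subgraph (with_proj H) (with_proj G)" "vertex_connected (k + 1) H"
      "real (card (pverts H)) > (1 + \<sigma>) * real k"
    then have "card (pverts H) \<le> n"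
      using V by (intro decomposable_no_large_vertex_connected[of k n E V])
        (auto simp: subgraph_def G_def)
    then show False using H(3) n by linarith
  qed
  ultimately show "\<exists>G :: nat pair_pre_digraph.
           pair_graph G \<and> card (pverts G) \<ge> N \<and>
           average_degree G > \<delta> * real k - 2 \<and>
           \<not> (\<exists>H :: nat pair_pre_digraph.
                 pair_graph H \<and> subgraph (with_proj H) (with_proj G) \<and>
                 vertex_connected (k + 1) H \<and>
                 real (card (pverts H)) > (1 + \<sigma>) * real k)"
    by blast
qed

end
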